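(* Let $a,\lambda,\eta>0$ and $0<\varphi<\frac{1}{\frac1T\|R\|_2^2+\eta\|A\|_2^2}$. Let $x^{*}\in\mathbb{R}^n$ be an optimal solution (global minimizer) of the problem $(FP_{a,\lambda,\eta})$. Then $$x^{*}=\mathcal{G}_{\lambda\varphi,P_a}(B_\varphi(x^{*})).$$
   Context: Let $T,n$ be positive integers, $r_1,\dots,r_T\in\mathbb{R}^n$ the vectors of asset returns, $R=(r_1,\dots,r_T)^\top\in\mathbb{R}^{T\times n}$, $\mu\in\mathbb{R}^n$ the (given) mean return vector, $\beta\in\mathbb{R}$, $e_m\in\mathbb{R}^m$ the vector of all ones, $A=(\mu,e_n)^\top\in\mathbb{R}^{2\times n}$, $b=(\beta,1)^\top\in\mathbb{R}^2$. For $a>0$ let $\rho_a(t)=\frac{a|t|}{a|t|+1}$ for $t\in\mathbb{R}$ and $P_a(x)=\sum_i\rho_a(x_i)$. For $\lambda,\eta>0$ the problem $(FP_{a,\lambda,\eta})$ is the minimization over $x\in\mathbb{R}^n$ of $$\frac1T\|Rx-\beta e_T\|_2^2+\lambda P_a(x)+\eta\|Ax-b\|_2^2 .$$ For $\varphi>0$ and $z\in\mathbb{R}^n$, $B_\varphi(z)=z+\frac{\varphi}{T}R^\top(\beta e_T-Rz)+\varphi\eta A^\top(b-Az)$. For matrices, $\|\cdot\|_2$ is the spectral norm. Thresholding operator: for $\nu>0$ and $\gamma\in\mathbb{R}$, $\mathrm{prox}_\nu^{\rho_a}(\gamma)$ is a minimizer over $t\in\mathbb{R}$ of $(t-\gamma)^2+\nu\rho_a(t)$,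 given (by a known result) by $$\mathrm{prox}_\nu^{\rho_a}(\gamma)=\begin{cases} g_{a,\nu}(\gamma), & |\gamma|>t^*_{a,\nu},\\ 0, & |\gamma|\le t^*_{a,\nu},\end{cases}$$ where $$g_{a,\nu}(\gamma)=\mathrm{sign}(\gamma)\,\frac{\frac{1+a|\gamma|}{3}\left(1+2\cos\left(\frac{\phi(\gamma)}{3}-\frac{\pi}{3}\right)\right)-1}{a},\qquad \phi(\gamma)=\arccos\Big(\frac{27\nu a^2}{4(1+a|\gamma|)^3}-1\Big),$$ and $t^*_{a,\nu}=\frac{\nu a}{2}$ if $\nu\le\frac1{a^2}$, $t^*_{a,\nu}=\sqrt{\nu}-\frac{1}{2a}$ if $\nu>\frac1{a^2}$. For $x\in\mathbb{R}^n$, $\mathcal{G}_{\nu,P_a}(x)=(\mathrm{prox}_\nu^{\rho_a}(x_1),\dots,\mathrm{prox}_\nu^{\rho_a}(x_n))^\top$. *)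

theory Defs
  imports "HOL-Analysis.Analysis"
begin

text \<open>
  Indices are finite types: assets are indexed by \<open>'n\<close> (so \<open>n = CARD('n)\<close>) and observation
  periods by \<open>'t\<close> (so \<open>T = CARD('t)\<close>). A matrix with \<open>m\<close> rows and \<open>n\<close> columns has type
  \<open>real ^ 'n ^ 'm\<close>, and \<open>norm\<close> on vectors is the Euclidean norm.
\<close>

definition ones :: "real ^ 'm" where
  "ones = (\<chi> i. 1)"

definition returns_mat :: "('t \<Rightarrow> real ^ 'n) \<Rightarrow> real ^ 'n ^ 't" where
  "returns_mat r = (\<chi> t. r t)"

definition constr_mat :: "real ^ 'n \<Rightarrow> real ^ 'n ^ 2" where
  "constr_mat \<mu> = vector [\<mu>, ones]"

definition constr_vec :: "real \<Rightarrow> real ^ 2" where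
  "constr_vec \<beta> = vector [\<beta>, 1]"

text \<open>
  The operator norm induced by the Euclidean norms; \<open>norm M\<close> would be the Frobenius norm.
\<close>

definition spectral_norm :: "real ^ 'n ^ 'm \<Rightarrow> real" where
  "spectral_norm M = onorm ((*v) M)"

definition frac_pen :: "real \<Rightarrow> real \<Rightarrow> real" where
  "frac_pen a t = a * \<bar>t\<bar> / (a * \<bar>t\<bar> + 1)"

definition frac_penalty :: "real \<Rightarrow> real ^ 'n \<Rightarrow> real" where
  "frac_penalty a x = (\<Sum>i\<in>UNIV. frac_pen a (x $ i))"

definition FP_objective ::
  "real \<Rightarrow> real \<Rightarrow> real \<Rightarrow> ('t::finite \<Rightarrow> real ^ 'n) \<Rightarrow> real ^ 'n \<Rightarrow> real \<Rightarrow> real ^ 'n \<Rightarrow> real" where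
  "FP_objective a lam \<eta> r \<mu> \<beta> x =
     1 / real CARD('t) * (norm (returns_mat r *v x - \<beta> *\<^sub>R ones))\<^sup>2
     + lam * frac_penalty a x
     + \<eta> * (norm (constr_mat \<mu> *v x - constr_vec \<beta>))\<^sup>2"

definition FP_optimal ::
  "real \<Rightarrow> real \<Rightarrow> real \<Rightarrow> ('t::finite \<Rightarrow> real ^ 'n) \<Rightarrow> real ^ 'n \<Rightarrow> real \<Rightarrow> real ^ 'n \<Rightarrow> bool" where
  "FP_optimal a lam \<eta> r \<mu> \<beta> x \<longleftrightarrow>
     (\<forall>y. FP_objective a lam \<eta> r \<mu> \<beta> x \<le> FP_objective a lam \<eta> r \<mu> \<beta> y)"

definition B_map ::
  "real \<Rightarrow> real \<Rightarrow> ('t::finite \<Rightarrow> real ^ 'n) \<Rightarrow> real ^ 'n \<Rightarrow> real \<Rightarrow> real ^ 'n \<Rightarrow> real ^ 'n" where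
  "B_map \<phi> \<eta> r \<mu> \<beta> z =
     z + (\<phi> / real CARD('t)) *\<^sub>R
           (transpose (returns_mat r) *v (\<beta> *\<^sub>R ones - returns_mat r *v z))
       + (\<phi> * \<eta>) *\<^sub>R (transpose (constr_mat \<mu>) *v (constr_vec \<beta> - constr_mat \<mu> *v z))"

definition thr_angle :: "real \<Rightarrow> real \<Rightarrow> real \<Rightarrow> real" where
  "thr_angle a \<nu> \<gamma> = arccos (27 * \<nu> * a\<^sup>2 / (4 * (1 + a * \<bar>\<gamma>\<bar>) ^ 3) - 1)"

definition thr_g :: "real \<Rightarrow> real \<Rightarrow> real \<Rightarrow> real" where
  "thr_g a \<nu> \<gamma> =
     sgn \<gamma> * (((1 + a * \<bar>\<gamma>\<bar>) / 3 * (1 + 2 * cos (thr_angle a \<nu> \<gamma> / 3 - pi / 3)) - 1) / a)"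

definition thr_value :: "real \<Rightarrow> real \<Rightarrow> real" where
  "thr_value a \<nu> = (if \<nu> \<le> 1 / a\<^sup>2 then \<nu> * a / 2 else sqrt \<nu> - 1 / (2 * a))"

text \<open>
  The closed form of a minimizer over \<open>t\<close> of \<open>(t - \<gamma>)\<^sup>2 + \<nu> * frac_pen a t\<close>. For \<open>\<nu> > 1 / a\<^sup>2\<close> the
  minimizer is not unique at \<open>\<bar>\<gamma>\<bar> = thr_value a \<nu>\<close>; the value \<open>0\<close> is selected there.
\<close>

definition prox_frac :: "real \<Rightarrow> real \<Rightarrow> real \<Rightarrow> real" where
  "prox_frac a \<nu> \<gamma> = (if \<bar>\<gamma>\<bar> > thr_value a \<nu> then thr_g a \<nu> \<gamma> else 0)"

definition thresholding :: "real \<Rightarrow> real \<Rightarrow> real ^ 'n \<Rightarrow> real ^ 'n" where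
  "thresholding a \<nu> x = (\<chi> i. prox_frac a \<nu> (x $ i))"

end

theory Submission
  imports Defs
begin

text \<open>
  Since \<open>\<phi>\<close> is strictly below the reciprocal Lipschitz constant of the smooth part,
  majorization makes every coordinate of an optimal solution the unique minimizer of its
  scalar proximal problem at \<open>B\<^sub>\<phi>(x\<^sup>*)\<close>; uniqueness excludes the ties of the thresholding operator.
  A nonzero scalar minimizer solves a cubic, and the second order condition singles out the
  root that Vieta's trigonometric formula expresses by \<open>thr_g\<close>.
\<close>

section \<open>The scalar problem: when zero is a minimizer\<close>

definition prox_obj :: "real \<Rightarrow> real \<Rightarrow> real \<Rightarrow> real \<Rightarrow> real" where
  "prox_obj a \<nu> \<gamma> t = (t - \<gamma>)\<^sup>2 + \<nu> * frac_pen a t"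

lemma frac_pen_minus [simp]: "frac_pen a (- t) = frac_pen a t"
  by (simp add: frac_pen_def)

lemma prox_obj_minus [simp]: "prox_obj a \<nu> (- \<gamma>) (- t) = prox_obj a \<nu> \<gamma> t"
  by (simp add: prox_obj_def power2_commute)

text \<open>Comparing a positive candidate with 0 comes down to the sign of the second factor. Half
  the infimum of \<open>t + \<nu> * a / (a * t + 1)\<close> over \<open>t > 0\<close> is exactly
  \<open>thr_value a \<nu>\<close>.\<close>

lemma prox_obj_pos_eq:
  assumes "a > 0" "t > 0"
  shows "prox_obj a \<nu> \<gamma> t - prox_obj a \<nu> \<gamma> 0 = t * (t + \<nu> * a / (a * t + 1) - 2 * \<gamma>)"
  using assms by (simp add: prox_obj_def frac_pen_def power2_eq_square algebra_simps)

lemma thr_value_lower: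
  assumes "a > 0" "\<nu> > 0" "t > 0"
  shows "2 * thr_value a \<nu> \<le> t + \<nu> * a / (a * t + 1)"
proof (cases "\<nu> \<le> 1 / a\<^sup>2")
  case True
  have p: "a * t + 1 > 0"
    using assms by (simp add: add_pos_pos)
  have "\<nu> * a\<^sup>2 \<le> 1"
    using True assms by (simp add: field_simps)
  then have "0 \<le> t * (a * t + (1 - \<nu> * a\<^sup>2)) / (a * t + 1)"
    using assms p by simp
  also have "\<dots> = t + \<nu> * a / (a * t + 1) - \<nu> * a"
    using p by (simp add: field_simps power2_eq_square)
  finally show ?thesis
    using True by (simp add: thr_value_def)
next
  case False
  \<comment> \<open>In \<open>u\<close> the expression is \<open>u + \<nu> / u - 1 / a\<close>, so
    AM-GM bounds it below by \<open>2 * sqrt \<nu> - 1 / a\<close>.\<close>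
  define u where "u = t + 1 / a"
  have u: "u > 0"
    using assms by (simp add: u_def add_pos_pos)
  have "0 \<le> (u - sqrt \<nu>)\<^sup>2 / u"
    using u by simp
  also have "\<dots> = u + \<nu> / u - 2 * sqrt \<nu>"
    using u assms by (simp add: power2_diff field_simps power2_eq_square)
  also have "\<nu> / u = \<nu> * a / (a * t + 1)"
    using assms by (simp add: u_def field_simps)
  finally show ?thesis
    using False assms by (simp add: thr_value_def u_def)
qed

lemma prox_obj_zero_le:
  assumes "a > 0" "\<nu> > 0" "\<bar>\<gamma>\<bar> \<le> thr_value a \<nu>"
  shows "prox_obj a \<nu> \<gamma> 0 \<le> prox_obj a \<nu> \<gamma> t"
proof -
  have pos: "prox_obj a \<nu> g 0 \<le> prox_obj a \<nu> g s" if "s > 0" "\<bar>g\<bar> \<le> thr_value a \<nu>" for g s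
  proof -
    have "0 \<le> s * (s + \<nu> * a / (a * s + 1) - 2 * g)"
      using thr_value_lower[of a \<nu> s] assms that by (intro mult_nonneg_nonneg) auto
    then show ?thesis
      using prox_obj_pos_eq[of a s \<nu> g] assms that by linarith
  qed
  consider "t = 0" | "t > 0" | "t < 0" by linarith
  then show ?thesis
  proof cases
    case 3
    then show ?thesis
      using pos[of "- t" "- \<gamma>"] assms prox_obj_minus[of a \<nu> \<gamma> 0] by simp
  qed (use pos assms in auto)
qed

lemma prox_obj_zero_not_min:
  assumes "a > 0" "\<nu> > 0" "\<gamma> > thr_value a \<nu>"
  obtains t where "t > 0" "prox_obj a \<nu> \<gamma> t < prox_obj a \<nu> \<gamma> 0"
proof -
  have "\<exists>t>0. t + \<nu> * a / (a * t + 1) < 2 * \<gamma>"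
  proof (cases "\<nu> \<le> 1 / a\<^sup>2")
    case True
    \<comment> \<open>Here the infimum \<open>\<nu> * a\<close> is only approached as t tends to 0.
      This t makes the sum equal to \<open>2 * \<gamma>\<close> once the fraction is replaced by its
      strict upper bound \<open>\<nu> * a\<close>.\<close>
    define t where "t = 2 * \<gamma> - \<nu> * a"
    have t: "t > 0"
      using True assms by (simp add: t_def thr_value_def)
    then have "\<nu> * a / (a * t + 1) < \<nu> * a"
      using assms by (simp add: divide_less_eq add_pos_pos)
    then show ?thesis
      using t by (intro exI[of _ t]) (simp add: t_def)
  next
    case False
    \<comment> \<open>The equality case of AM-GM; it is positive exactly because
      \<open>\<nu> > 1 / a\<^sup>2\<close>.\<close>
    define t where "t = sqrt \<nu> - 1 / a"
    have "sqrt (1 / a\<^sup>2) < sqrt \<nu>"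
      using False by simp
    then have t: "t > 0"
      using assms by (simp add: t_def real_sqrt_divide)
    have "a * t + 1 = a * sqrt \<nu>"
      using assms by (simp add: t_def field_simps)
    then have "\<nu> * a / (a * t + 1) = sqrt \<nu>"
      using assms by (simp add: real_div_sqrt)
    then show ?thesis
      using t False assms by (intro exI[of _ t]) (simp add: t_def thr_value_def)
  qed
  then obtain t where t: "t > 0" "t + \<nu> * a / (a * t + 1) - 2 * \<gamma> < 0"
    by auto
  then show ?thesis
    using that[of t] prox_obj_pos_eq[of a t \<nu> \<gamma>] assms mult_pos_neg[OF t] by linarith
qed

section \<open>The nonzero minimizer as a root of a cubic\<close>

lemma thr_value_nonneg:
  assumes "a > 0" "\<nu> > 0"
  shows "thr_value a \<nu> \<ge> 0"
proof (cases "\<nu> \<le> 1 / a\<^sup>2")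
  case False
  then have "sqrt (1 / a\<^sup>2) < sqrt \<nu>"
    by simp
  then have "1 / a < sqrt \<nu>"
    using assms by (simp add: real_sqrt_divide)
  moreover have "1 / (2 * a) \<le> 1 / a"
    using assms by (simp add: field_simps)
  ultimately show ?thesis
    using False by (simp add: thr_value_def)
qed (use assms in \<open>simp add: thr_value_def\<close>)

text \<open>Up to a positive factor and an additive constant, the scalar objective on
  \<open>t > 0\<close> has this form in the variable \<open>a * t + 1\<close>. The cubic is the
  stationarity equation, the inequality the second order condition.\<close>

lemma shifted_inverse_min_root:
  fixes c d y :: real
  assumes "y > 1"
    and min: "\<And>z. z > 1 \<Longrightarrow> (y - c)\<^sup>2 - 2 * d / y \<le> (z - c)\<^sup>2 - 2 * d / z"
  shows "y ^ 3 - c * y\<^sup>2 + d = 0" and "2 * d \<le> y ^ 3"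
proof -
  have "((\<lambda>z. (z - c)\<^sup>2 - 2 * d / z) has_real_derivative (2 * (y - c) + 2 * d / y\<^sup>2)) (at y)"
    using assms(1) by (auto intro!: derivative_eq_intros simp: power2_eq_square)
  then have "2 * (y - c) + 2 * d / y\<^sup>2 = 0"
  \<comment> \<open>The radius \<open>y - 1\<close> keeps the neighbourhood inside the region
    \<open>z > 1\<close> where minimality is assumed.\<close>
  proof (rule DERIV_local_min[of _ _ _ "y - 1"])
    show "\<forall>z. \<bar>y - z\<bar> < y - 1 \<longrightarrow> (y - c)\<^sup>2 - 2 * d / y \<le> (z - c)\<^sup>2 - 2 * d / z"
      using min by auto
  qed (use assms(1) in simp)
  then show root: "y ^ 3 - c * y\<^sup>2 + d = 0"
    using assms(1) by (simp add: field_simps power3_eq_cube power2_eq_square)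
  \<comment> \<open>Eliminating d by the cubic makes the objective gap a square times
    \<open>1 - 2 * d / (y\<^sup>2 * z)\<close>. This factor must be nonnegative; letting z decrease
    to y replaces a second derivative.\<close>
  have "2 * d / y\<^sup>2 \<le> z" if "y < z" for z
  proof -
    have d: "d = (c - y) * y\<^sup>2"
      using root by (simp add: algebra_simps power2_eq_square power3_eq_cube)
    then have "(z - c)\<^sup>2 - 2 * d / z - ((y - c)\<^sup>2 - 2 * d / y) = (z - y)\<^sup>2 * (1 - 2 * d / (y\<^sup>2 * z))"
      unfolding d using assms(1) that
      by (simp add: field_simps power2_eq_square)
    moreover have "(z - c)\<^sup>2 - 2 * d / z - ((y - c)\<^sup>2 - 2 * d / y) \<ge> 0"
      using min[of z] assms(1) that by simp
    ultimately have "1 - 2 * d / (y\<^sup>2 * z) \<ge> 0"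
      using that by (simp add: zero_le_mult_iff)
    then show ?thesis
      using assms(1) that by (simp add: field_simps)
  qed
  then have "2 * d / y\<^sup>2 \<le> y"
    by (rule dense_ge)
  then show "2 * d \<le> y ^ 3"
    using assms(1) by (simp add: field_simps power2_eq_square power3_eq_cube)
qed

text \<open>The scaling \<open>y = c / 3 * (1 + 2 * u)\<close> turns the cubic into
  \<open>4 * u ^ 3 - 3 * u = 1 - 27 * d / (2 * c ^ 3)\<close>, the triple angle formula for
  \<open>u = cos t\<close>. The second order condition gives \<open>y \<ge> 2 * c / 3\<close>, that
  is \<open>u \<ge> 1 / 2\<close>, so \<open>3 * t\<close> lies in the range where arccos inverts
  cos.\<close>

lemma largest_cubic_root:
  fixes c d y :: real
  assumes "y > 0" "c > 0" "d > 0" and root: "y ^ 3 - c * y\<^sup>2 + d = 0" and "2 * d \<le> y ^ 3"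
  shows "y = c / 3 * (1 + 2 * cos (arccos (27 * d / (2 * c ^ 3) - 1) / 3 - pi / 3))"
proof -
  define u where "u = (3 * y / c - 1) / 2"
  have y: "y = c / 3 * (1 + 2 * u)"
    using assms by (simp add: u_def diff_divide_distrib)
  have sq: "y\<^sup>2 * (c - y) = d"
    using root by (simp add: algebra_simps power2_eq_square power3_eq_cube)
  then have "c - y > 0"
    using assms by (metis zero_less_mult_pos zero_less_power)
  then have u1: "u < 1"
    using assms by (simp add: u_def field_simps)
  have "y\<^sup>2 * (2 * (c - y)) \<le> y\<^sup>2 * y"
    using assms(5) unfolding sq[symmetric] by (simp add: power2_eq_square power3_eq_cube algebra_simps)
  then have "2 * (c - y) \<le> y"
    using assms(1) by (simp add: mult_le_cancel_left)
  then have u2: "1 / 2 \<le> u"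
    using assms by (simp add: u_def field_simps)
  define t where "t = arccos u"
  have ct: "cos t = u"
    using u1 u2 by (simp add: t_def)
  have "t \<ge> 0"
    using u1 u2 by (simp add: t_def arccos_lbound)
  have "arccos u \<le> arccos (1 / 2)"
    using u1 u2 by (intro arccos_le_arccos) auto
  also have "arccos (1 / 2 :: real) = pi / 3"
    by (metis arccos_cos cos_60 pi_ge_zero divide_nonneg_nonneg zero_le_numeral
        pi_gt_zero divide_le_eq_numeral1(1) mult_le_cancel_left1 one_le_numeral not_le)
  finally have t: "3 * t \<le> pi"
    by (simp add: t_def)
  have "27 * d / (2 * c ^ 3) = 1 - (4 * u ^ 3 - 3 * u)"
    unfolding sq[symmetric] y using assms
    by (simp add: field_simps power2_eq_square power3_eq_cube)
  \<comment> \<open>The sign is opposite to \<open>cos (3 * t)\<close>, hence the reflection to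
    \<open>pi - 3 * t\<close>; the shift by \<open>pi / 3\<close> in the formula undoes it.\<close>
  then have "27 * d / (2 * c ^ 3) - 1 = cos (pi - 3 * t)"
    using cos_treble_cos[of t] ct by simp
  then have "arccos (27 * d / (2 * c ^ 3) - 1) = pi - 3 * t"
    using t \<open>t \<ge> 0\<close> by (simp add: arccos_cos del: cos_pi_minus)
  then have "arccos (27 * d / (2 * c ^ 3) - 1) / 3 - pi / 3 = - t"
    by (simp add: field_simps)
  then show ?thesis
    using y ct by simp
qed

lemma prox_obj_min_thr_g:
  assumes "a > 0" "\<nu> > 0" "\<gamma> > thr_value a \<nu>"
    and min: "\<And>t. prox_obj a \<nu> \<gamma> x \<le> prox_obj a \<nu> \<gamma> t"
  shows "x = thr_g a \<nu> \<gamma>"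
proof -
  have g: "\<gamma> > 0"
    using thr_value_nonneg[of a \<nu>] assms by linarith
  have "x \<noteq> 0"
    using prox_obj_zero_not_min[OF assms(1-3)] min by (metis not_le)
  moreover have "\<not> x < 0"
  proof
    assume "x < 0"
    then have "x * \<gamma> < 0"
      using g by (simp add: mult_neg_pos)
    \<comment> \<open>The penalty is even, so reflecting x to the side of \<open>\<gamma>\<close>
      lowers only the quadratic term.\<close>
    then show False
      using min[of "- x"] by (simp add: prox_obj_def power2_eq_square algebra_simps)
  qed
  ultimately have x: "x > 0" by simp
  \<comment> \<open>Since \<open>frac_pen a t = 1 - 1 / (a * t + 1)\<close> for
    \<open>t > 0\<close>, multiplying the objective by \<open>a\<^sup>2\<close> gives the shifted
    inverse form with these c and d.\<close>
  define c d y where "c = 1 + a * \<gamma>" and "d = \<nu> * a\<^sup>2 / 2" and "y = a * x + 1"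
  have y: "y > 1" and c: "c > 0" and d: "d > 0"
    using x g assms by (auto simp: c_def d_def y_def add_pos_pos)
  have obj: "a\<^sup>2 * prox_obj a \<nu> \<gamma> t = (a * t + 1 - c)\<^sup>2 - 2 * d / (a * t + 1) + 2 * d" if "t > 0" for t
  proof -
    have p: "a * t + 1 > 0"
      using that assms by (simp add: add_pos_pos)
    have "frac_pen a t = 1 - 1 / (a * t + 1)"
      using p that assms by (simp add: frac_pen_def field_simps)
    moreover have "a\<^sup>2 * (t - \<gamma>)\<^sup>2 = (a * t + 1 - c)\<^sup>2"
      by (simp add: c_def power2_eq_square algebra_simps)
    ultimately show ?thesis
      by (simp add: prox_obj_def d_def distrib_left right_diff_distrib)
  qed
  have "(y - c)\<^sup>2 - 2 * d / y \<le> (z - c)\<^sup>2 - 2 * d / z" if "z > 1" for z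
  proof -
    have z: "a * ((z - 1) / a) + 1 = z" "(z - 1) / a > 0"
      using that assms by simp_all
    have "a\<^sup>2 * prox_obj a \<nu> \<gamma> x \<le> a\<^sup>2 * prox_obj a \<nu> \<gamma> ((z - 1) / a)"
      using min by (simp add: mult_left_mono)
    then show ?thesis
      unfolding obj[OF x] obj[OF z(2)] z(1) y_def by simp
  qed
  from shifted_inverse_min_root[OF y this] have
    "y = c / 3 * (1 + 2 * cos (arccos (27 * d / (2 * c ^ 3) - 1) / 3 - pi / 3))"
    using y c d by (intro largest_cubic_root) auto
  moreover have "27 * d / (2 * c ^ 3) = 27 * \<nu> * a\<^sup>2 / (4 * (1 + a * \<bar>\<gamma>\<bar>) ^ 3)"
    using g by (simp add: c_def d_def)
  ultimately have "y = (1 + a * \<bar>\<gamma>\<bar>) / 3 * (1 + 2 * cos (thr_angle a \<nu> \<gamma> / 3 - pi / 3))"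
    using g by (simp add: thr_angle_def c_def)
  moreover have "x = (y - 1) / a"
    using assms by (simp add: y_def)
  ultimately show ?thesis
    using g by (simp add: thr_g_def)
qed

lemma unique_min_prox_frac:
  assumes "a > 0" "\<nu> > 0"
    and less: "\<And>t. t \<noteq> x \<Longrightarrow> prox_obj a \<nu> \<gamma> x < prox_obj a \<nu> \<gamma> t"
  shows "x = prox_frac a \<nu> \<gamma>"
proof -
  have min: "prox_obj a \<nu> \<gamma> x \<le> prox_obj a \<nu> \<gamma> t" for t
    using less[of t] by (cases "t = x") auto
  consider "\<bar>\<gamma>\<bar> \<le> thr_value a \<nu>" | "\<gamma> > thr_value a \<nu>" | "- \<gamma> > thr_value a \<nu>" by linarith
  then show ?thesis
  proof cases
    case 1
    \<comment> \<open>Zero is a minimizer up to and including the threshold; strict minimality of x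
      rules out a nonzero tie there.\<close>
    then have "x = 0"
      using less[of 0] prox_obj_zero_le[OF assms(1,2) 1, of x] by force
    then show ?thesis
      using 1 by (simp add: prox_frac_def)
  next
    case 2
    then show ?thesis
      using prox_obj_min_thr_g[OF assms(1,2) 2 min] by (simp add: prox_frac_def)
  next
    case 3
    have "prox_obj a \<nu> (- \<gamma>) (- x) \<le> prox_obj a \<nu> (- \<gamma>) t" for t
      using min[of "- t"] prox_obj_minus[of a \<nu> \<gamma> "- t"] by simp
    from prox_obj_min_thr_g[OF assms(1,2) 3 this] have "x = thr_g a \<nu> \<gamma>"
      by (simp add: thr_g_def thr_angle_def sgn_minus)
    then show ?thesis
      using 3 by (simp add: prox_frac_def)
  qed
qed

section \<open>From the portfolio objective to its coordinates\<close>

lemma norm_mult_vec_le_spectral_norm: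
  "norm (M *v x) \<le> spectral_norm M * norm x"
  unfolding spectral_norm_def by (rule onorm[OF matrix_vector_mul_bounded_linear])

lemma norm_sq_affine_expand:
  fixes M :: "real ^ 'n ^ 'm"
  shows "(norm (M *v (x + v) - q))\<^sup>2 =
    (norm (M *v x - q))\<^sup>2 - 2 * (v \<bullet> (transpose M *v (q - M *v x))) + (norm (M *v v))\<^sup>2"
proof -
  have "v \<bullet> (transpose M *v (q - M *v x)) = (M *v v) \<bullet> (q - M *v x)"
    by (metis dot_lmul_matrix vector_transpose_matrix inner_commute)
  then show ?thesis
    by (simp add: matrix_vector_right_distrib power2_norm_eq_inner inner_diff_left inner_diff_right
        inner_add_left inner_add_right inner_commute)
qed

lemma frac_penalty_add_axis:
  "frac_penalty a (x + axis i s) = frac_penalty a x + frac_pen a (x $ i + s) - frac_pen a (x $ i)"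
proof -
  have "frac_penalty a (x + axis i s) - frac_penalty a x =
      (\<Sum>j\<in>UNIV. if j = i then frac_pen a (x $ i + s) - frac_pen a (x $ i) else 0)"
    unfolding frac_penalty_def sum_subtractf[symmetric]
    by (intro sum.cong) (auto simp: axis_def)
  then show ?thesis by simp
qed

text \<open>\<open>B_map\<close> is a gradient step on the smooth part, so
  \<open>B_map \<phi> \<eta> r \<mu> \<beta> x - x\<close> collects the linear terms of both
  squares. The expansion is exact; only its quadratic remainder needs an estimate.\<close>

lemma FP_objective_add:
  fixes r :: "'t::finite \<Rightarrow> real ^ 'n"
  assumes "\<phi> > 0"
  shows "\<phi> * (FP_objective a lam \<eta> r \<mu> \<beta> (x + v) - FP_objective a lam \<eta> r \<mu> \<beta> x) =
    lam * \<phi> * (frac_penalty a (x + v) - frac_penalty a x) - 2 * (v \<bullet> (B_map \<phi> \<eta> r \<mu> \<beta> x - x))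
    + \<phi> * (1 / real CARD('t) * (norm (returns_mat r *v v))\<^sup>2 + \<eta> * (norm (constr_mat \<mu> *v v))\<^sup>2)"
  unfolding FP_objective_def norm_sq_affine_expand B_map_def
  by (simp add: inner_add_right algebra_simps add_divide_distrib diff_divide_distrib)

text \<open>Perturbing a single coordinate changes one penalty term, and the step size makes the
  quadratic remainder strictly smaller than the square of the change. That slack yields the strict
  inequality.\<close>

lemma FP_optimal_coordinate_less:
  fixes r :: "'t::finite \<Rightarrow> real ^ 'n"
  assumes "\<eta> > 0" "\<phi> > 0"
    and step: "\<phi> < 1 / (1 / real CARD('t) * (spectral_norm (returns_mat r))\<^sup>2
                    + \<eta> * (spectral_norm (constr_mat \<mu>))\<^sup>2)"
    and opt: "FP_optimal a lam \<eta> r \<mu> \<beta> x"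
    and "t \<noteq> x $ i"
  shows "prox_obj a (lam * \<phi>) (B_map \<phi> \<eta> r \<mu> \<beta> x $ i) (x $ i)
       < prox_obj a (lam * \<phi>) (B_map \<phi> \<eta> r \<mu> \<beta> x $ i) t"
proof -
  define L where "L = 1 / real CARD('t) * (spectral_norm (returns_mat r))\<^sup>2
                    + \<eta> * (spectral_norm (constr_mat \<mu>))\<^sup>2"
  define s where "s = t - x $ i"
  define v :: "real ^ 'n" where "v = axis i s"
  define b where "b = B_map \<phi> \<eta> r \<mu> \<beta> x $ i"
  \<comment> \<open>As \<open>1 / 0 = 0\<close>, the bounds on \<open>\<phi>\<close> also exclude
    \<open>L = 0\<close>.\<close>
  have "1 / L > 0"
    using step assms(2) unfolding L_def by linarith
  then have "L > 0"
    by simp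
  then have "\<phi> * L < 1"
    using step unfolding L_def[symmetric] by (simp add: field_simps)
  have nv: "(norm v)\<^sup>2 = s\<^sup>2"
    unfolding v_def power2_norm_eq_inner by (simp add: inner_axis_axis power2_eq_square)
  have bound: "(norm (M *v v))\<^sup>2 \<le> (spectral_norm M)\<^sup>2 * s\<^sup>2" for M :: "real ^ 'n ^ 'm"
    using power_mono[OF norm_mult_vec_le_spectral_norm[of M v], of 2]
    by (simp add: power_mult_distrib nv)
  have "1 / real CARD('t) * (norm (returns_mat r *v v))\<^sup>2
      \<le> 1 / real CARD('t) * ((spectral_norm (returns_mat r))\<^sup>2 * s\<^sup>2)"
    using bound by (intro mult_left_mono) auto
  moreover have "\<eta> * (norm (constr_mat \<mu> *v v))\<^sup>2 \<le> \<eta> * ((spectral_norm (constr_mat \<mu>))\<^sup>2 * s\<^sup>2)"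
    using bound assms(1) by (intro mult_left_mono) auto
  ultimately have "1 / real CARD('t) * (norm (returns_mat r *v v))\<^sup>2
      + \<eta> * (norm (constr_mat \<mu> *v v))\<^sup>2 \<le> L * s\<^sup>2"
    unfolding L_def by (simp add: algebra_simps)
  then have "\<phi> * (1 / real CARD('t) * (norm (returns_mat r *v v))\<^sup>2
      + \<eta> * (norm (constr_mat \<mu> *v v))\<^sup>2) \<le> \<phi> * (L * s\<^sup>2)"
    using assms(2) by (intro mult_left_mono) auto
  \<comment> \<open>Strict because \<open>t \<noteq> x $ i\<close> gives
    \<open>s \<noteq> 0\<close>.\<close>
  also have "\<phi> * (L * s\<^sup>2) < s\<^sup>2"
    using mult_strict_right_mono[OF \<open>\<phi> * L < 1\<close>, of "s\<^sup>2"] assms(5) by (simp add: s_def mult.assoc)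
  finally have quad: "\<phi> * (1 / real CARD('t) * (norm (returns_mat r *v v))\<^sup>2
      + \<eta> * (norm (constr_mat \<mu> *v v))\<^sup>2) < s\<^sup>2" .
  have "0 \<le> \<phi> * (FP_objective a lam \<eta> r \<mu> \<beta> (x + v) - FP_objective a lam \<eta> r \<mu> \<beta> x)"
    using opt assms(2) by (simp add: FP_optimal_def)
  also have "\<dots> < lam * \<phi> * (frac_penalty a (x + v) - frac_penalty a x)
      - 2 * (v \<bullet> (B_map \<phi> \<eta> r \<mu> \<beta> x - x)) + s\<^sup>2"
    using quad unfolding FP_objective_add[OF assms(2)] by linarith
  also have "\<dots> = lam * \<phi> * (frac_pen a t - frac_pen a (x $ i)) - 2 * (s * (b - x $ i)) + s\<^sup>2"
    unfolding v_def frac_penalty_add_axis by (simp add: inner_axis' s_def b_def)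
  \<comment> \<open>With \<open>t = x $ i + s\<close>, the linear term and \<open>s\<^sup>2\<close>
    combine to \<open>(t - b)\<^sup>2 - (x $ i - b)\<^sup>2\<close>.\<close>
  also have "\<dots> = prox_obj a (lam * \<phi>) b t - prox_obj a (lam * \<phi>) b (x $ i)"
    by (simp add: prox_obj_def s_def power2_eq_square algebra_simps)
  finally show ?thesis
    by (simp add: b_def)
qed

theorem corollary2:
  fixes a lam \<eta> \<phi> \<beta> :: real
    and r :: "'t::finite \<Rightarrow> real ^ 'n"
    and \<mu> xstar :: "real ^ 'n"
  assumes "a > 0" and "lam > 0" and "\<eta> > 0"
    and "0 < \<phi>"
    and "\<phi> < 1 / (1 / real CARD('t) * (spectral_norm (returns_mat r))\<^sup>2
                    + \<eta> * (spectral_norm (constr_mat \<mu>))\<^sup>2)"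
    and "FP_optimal a lam \<eta> r \<mu> \<beta> xstar"
  shows "xstar = thresholding a (lam * \<phi>) (B_map \<phi> \<eta> r \<mu> \<beta> xstar)"
proof -
  have "xstar $ i = prox_frac a (lam * \<phi>) (B_map \<phi> \<eta> r \<mu> \<beta> xstar $ i)" for i
    using assms by (intro unique_min_prox_frac FP_optimal_coordinate_less) auto
  then show ?thesis
    by (simp add: thresholding_def vec_eq_iff)
qed

end
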